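(* Let $k=k(n)$ be an integer and $f(n)$ a function such that, for all sufficiently large $n$, $1\le k<\lfloor\frac n2\rfloor$ and $k(n-1)\le f(n)<rmc_k(K_n)$. Define $$p(n)=\begin{cases}\dfrac{f(n)+kn}{n^2}, & \text{if } f(n)\ge s\, n\log n \text{ for some constant } s>0 \text{ and } k=o(n);\\[2mm] \max\left\{\dfrac kn,\dfrac{\log n}{n}\right\}, & \text{if } f(n)=o(n\log n)\text{ and }k=o(n);\\[2mm] 1, & \text{if } k\ge \ell n \text{ for some constant } \ell>0.\end{cases}$$ Then in each of the three cases $p(n)$ is a sharp threshold function for the property $rmc_k(G(n,p))\ge f(n)$.
   Context: An edge-coloring of a graph assigns a color to each edge; adjacent edges may receive the same color. A path is monochromatic if all its edges have the same color. For distinct vertices $u,v$ of an edge-colored graph, $k$ rainbow monochromatic $uv$-paths are $k$ edge-disjoint monochromatic $uv$-paths whose colors are pairwise different. An edge-coloring of a simple graph $G$ is an $RMC_k$-coloring if every two distinct vertices of $G$ are connected by at least $k$ rainbow monochromatic paths. For a graph $G$ having an $RMC_k$-coloring, $rmc_k(G)$ is the maximum number of colors used in an $RMC_k$-coloring of $G$. The property $rmc_k(G)\ge f(n)$ means that $G$ has an $RMC_k$-coloring and $rmc_k(G)\ge f(n)$; a graph without an $RMC_k$-coloring does not have the property. $K_n$ is the complete graph on $n$ vertices, and $G(n,p)$ is the Erdős–Rényi random graph on $n$ labeled vertices in which each edge is present independently with probability $p\in[0,1]$. An event or property holds almost surely if its probability tends to $1$ as $n\to\infty$. A function $h(n)$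 is a sharp threshold function of a property $Q$ if there are two positive constants $c_1,c_2$ such that, for edge probabilities $q=q(n)\in[0,1]$, $G(n,q(n))$ almost surely does not have property $Q$ when $q(n)\le c_1h(n)$, and $G(n,q(n))$ almost surely has property $Q$ when $q(n)\ge c_2h(n)$. $\log$ is the natural logarithm; $a(n)=o(b(n))$ means $a(n)/b(n)\to 0$. *)

theory Defs
  imports "HOL-Probability.Probability" "HOL-Library.Ramsey" "HOL-Library.Landau_Symbols"
begin

text \<open>
  A finite simple graph is given by its vertex set \<open>V\<close> and its edge set
  \<open>E \<subseteq> nsets V 2\<close>, a set of two-element subsets of \<open>V\<close>. In particular
  \<open>nsets V 2\<close> itself is the edge set of the complete graph on \<open>V\<close>.
  A path is represented by the list of its vertices.
\<close>

fun path_edges :: "'a list \<Rightarrow> 'a set list" where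
  "path_edges (x # y # xs) = {x, y} # path_edges (y # xs)"
| "path_edges _ = []"

definition is_path :: "'a set set \<Rightarrow> 'a \<Rightarrow> 'a \<Rightarrow> 'a list \<Rightarrow> bool" where
  "is_path E u v p \<longleftrightarrow>
     p \<noteq> [] \<and> hd p = u \<and> last p = v \<and> distinct p \<and> set (path_edges p) \<subseteq> E"

definition monochromatic :: "('a set \<Rightarrow> nat) \<Rightarrow> 'a list \<Rightarrow> bool" where
  "monochromatic col p \<longleftrightarrow> (\<exists>c. \<forall>e\<in>set (path_edges p). col e = c)"

text \<open>Only meaningful for a monochromatic path with at least one edge, hence for every
  monochromatic path between distinct vertices.\<close>

definition path_color :: "('a set \<Rightarrow> nat) \<Rightarrow> 'a list \<Rightarrow> nat" where
  "path_color col p = col (hd (path_edges p))"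

definition rainbow_mono_paths ::
    "'a set set \<Rightarrow> ('a set \<Rightarrow> nat) \<Rightarrow> 'a \<Rightarrow> 'a \<Rightarrow> 'a list set \<Rightarrow> bool" where
  "rainbow_mono_paths E col u v P \<longleftrightarrow>
     (\<forall>p\<in>P. is_path E u v p \<and> monochromatic col p) \<and>
     pairwise (\<lambda>p q. disjnt (set (path_edges p)) (set (path_edges q)) \<and>
                     path_color col p \<noteq> path_color col q) P"

text \<open>Colors are natural numbers, which suffices for finite graphs. A coloring is a total
  function, but only its values on the edges in \<open>E\<close> matter.\<close>

definition rmc_coloring :: "nat \<Rightarrow> 'a set \<Rightarrow> 'a set set \<Rightarrow> ('a set \<Rightarrow> nat) \<Rightarrow> bool" where
  "rmc_coloring k V E col \<longleftrightarrow>
     (\<forall>u\<in>V. \<forall>v\<in>V. u \<noteq> v \<longrightarrow>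
        (\<exists>P. finite P \<and> k \<le> card P \<and> rainbow_mono_paths E col u v P))"

text \<open>The maximum is over a finite set (bounded by \<open>card E\<close>). It is unspecified when there is
  no such coloring. For complete graphs on \<open>n\<close> vertices and \<open>k \<le> n div 2\<close> there is
  always one, since \<open>n div 2\<close> edge-disjoint Hamiltonian paths exist.\<close>

definition rmc :: "nat \<Rightarrow> 'a set \<Rightarrow> 'a set set \<Rightarrow> nat" where
  "rmc k V E = Max {card (col ` E) |col. rmc_coloring k V E col}"

definition rmc_at_least :: "nat \<Rightarrow> 'a set \<Rightarrow> real \<Rightarrow> 'a set set \<Rightarrow> bool" where
  "rmc_at_least k V r E \<longleftrightarrow> (\<exists>col. rmc_coloring k V E col) \<and> r \<le> real (rmc k V E)"

text \<open>The distribution of the edge set of \<open>G(n,p)\<close> on the vertex set \<open>{..<n}\<close>.\<close>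

definition random_graph :: "nat \<Rightarrow> real \<Rightarrow> nat set set pmf" where
  "random_graph n p =
     map_pmf (\<lambda>present. {e \<in> nsets {..<n} 2. present e})
       (Pi_pmf (nsets {..<n} 2) False (\<lambda>_. bernoulli_pmf p))"

definition almost_surely :: "(nat \<Rightarrow> real) \<Rightarrow> (nat \<Rightarrow> nat set set \<Rightarrow> bool) \<Rightarrow> bool" where
  "almost_surely q Q \<longleftrightarrow>
     (\<lambda>n. measure_pmf.prob (random_graph n (q n)) {E. Q n E}) \<longlonglongrightarrow> 1"

text \<open>The comparisons of \<open>q\<close> with \<open>h\<close> are asymptotic. Demanding them for every \<open>n\<close> would
  make the condition depend on irrelevant small values of \<open>h\<close>, and possibly vacuous.\<close>

definition sharp_threshold :: "(nat \<Rightarrow> real) \<Rightarrow> (nat \<Rightarrow> nat set set \<Rightarrow> bool) \<Rightarrow> bool" where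
  "sharp_threshold h Q \<longleftrightarrow>
     (\<exists>c1>0. \<exists>c2>0. \<forall>q. (\<forall>n. q n \<in> {0..1}) \<longrightarrow>
        ((\<forall>\<^sub>F n in sequentially. q n \<le> c1 * h n) \<longrightarrow> almost_surely q (\<lambda>n E. \<not> Q n E)) \<and>
        ((\<forall>\<^sub>F n in sequentially. q n \<ge> c2 * h n) \<longrightarrow> almost_surely q Q))"

end

theory Submission
  imports Defs "HOL-Real_Asymp.Real_Asymp"
begin

text \<open>
  Both directions of the threshold are about edge counts.

  If the property holds, the graph has at least \<open>f\<close> edges and, as \<open>k \<ge> 1\<close>, no isolated vertex.
  When \<open>q n\<^sup>2\<close> is a small multiple of \<open>f\<close>, the first fails almost surely, by Markov's inequality for
  \<open>2 ^ card E\<close> (\<open>almost_surely_not_rmc_of_sparse\<close>). This covers the first case and the third, since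
  \<open>f \<ge> k (n - 1)\<close>. When \<open>q n\<close> is a small multiple of \<open>ln n\<close>, there is an isolated vertex almost
  surely, by a second moment estimate (\<open>almost_surely_not_rmc_below_log\<close>). This covers the second
  case, in which \<open>f = o(n ln n)\<close> forces \<open>k = o(ln n)\<close>.

  For the converse, \<open>K\<close> edge-disjoint spanning trees give such a coloring with at least
  \<open>(K - k) (n - 1)\<close> colors: \<open>k\<close> of the trees become color classes, which connect any two vertices by
  \<open>k\<close> monochromatic paths of different colors, and the edges of the others get colors of their own
  (\<open>rmc_at_least_of_packing\<close>). So \<open>K\<close> of about \<open>k + f / n\<close> trees suffice, and they have to be found
  in a random graph whose average degree \<open>q n\<close> is a large multiple of \<open>k\<close>, of \<open>f / n\<close> and of
  \<open>ln n\<close>.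

  The trees come from Edmonds' theorem (\<open>Edmonds_branchings\<close>): a digraph in which at least \<open>K\<close>
  arcs enter each nonempty vertex set avoiding the root contains \<open>K\<close> arc-disjoint spanning
  arborescences. To apply it to an undirected graph, fix an orientation of the complete graph such
  that each cut is crossed in either direction by a constant fraction of its pairs, which the
  rotational tournament satisfies (\<open>rotation_cut\<close>). The random graph inherits this orientation,
  and the number of arcs that enter a set \<open>S\<close> is binomial with mean of order \<open>q m n\<close>, where \<open>m\<close> is
  the size of the smaller one of \<open>S\<close> and its complement. It is below \<open>K\<close> with probability at most
  \<open>n powr (- 4 * m)\<close>, and the sum of this over all \<open>S\<close> tends to \<open>0\<close> (\<open>prob_not_rmc_at_least\<close>).

  In the third case the upper constant is \<open>1\<close>, where the graph is complete and only the existence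
  of a coloring has to be shown; the same orientation provides it
  (\<open>rmc_coloring_complete_graph\<close>).
\<close>

section \<open>Edmonds' disjoint arborescences\<close>

definition in_arcs :: "('a \<times> 'a) set \<Rightarrow> 'a set \<Rightarrow> ('a \<times> 'a) set" where
  "in_arcs D S = {(u, v) \<in> D. u \<notin> S \<and> v \<in> S}"

lemma finite_in_arcs: "finite D \<Longrightarrow> finite (in_arcs D S)"
  by (rule finite_subset[of _ D]) (auto simp: in_arcs_def)

text \<open>
  An arc that enters \<open>S \<inter> T\<close> or \<open>S \<union> T\<close> enters \<open>S\<close> or \<open>T\<close>, and one that enters both enters both.
\<close>

lemma in_arcs_submodular:
  assumes "finite D"
  shows "card (in_arcs D (S \<inter> T)) + card (in_arcs D (S \<union> T))
    \<le> card (in_arcs D S) + card (in_arcs D T)"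
proof -
  have "card (in_arcs D (S \<inter> T)) + card (in_arcs D (S \<union> T))
      = card (in_arcs D (S \<inter> T) \<union> in_arcs D (S \<union> T))
        + card (in_arcs D (S \<inter> T) \<inter> in_arcs D (S \<union> T))"
    using assms by (intro card_Un_Int finite_in_arcs)
  also have "\<dots> \<le> card (in_arcs D S \<union> in_arcs D T) + card (in_arcs D S \<inter> in_arcs D T)"
    using assms by (intro add_mono card_mono) (auto simp: finite_in_arcs, auto simp: in_arcs_def)
  also have "\<dots> = card (in_arcs D S) + card (in_arcs D T)"
    using assms by (intro card_Un_Int[symmetric] finite_in_arcs)
  finally show ?thesis .
qed

definition in_connected :: "nat \<Rightarrow> 'a \<Rightarrow> 'a set \<Rightarrow> ('a \<times> 'a) set \<Rightarrow> bool" where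
  "in_connected k r V D \<longleftrightarrow> (\<forall>S\<subseteq>V - {r}. S \<noteq> {} \<longrightarrow> k \<le> card (in_arcs D S))"

lemma in_connectedD:
  "in_connected k r V D \<Longrightarrow> S \<subseteq> V - {r} \<Longrightarrow> S \<noteq> {} \<Longrightarrow> k \<le> card (in_arcs D S)"
  by (simp add: in_connected_def)

text \<open>
  With \<open>card W - 1\<close> arcs and every vertex reachable from \<open>r\<close>, these are the spanning
  arborescences of \<open>W\<close> rooted at \<open>r\<close>; the arc count rules out superfluous arcs.
\<close>

definition branching :: "'a \<Rightarrow> 'a set \<Rightarrow> ('a \<times> 'a) set \<Rightarrow> bool" where
  "branching r W A \<longleftrightarrow>
     r \<in> W \<and> A \<subseteq> W \<times> W \<and> Suc (card A) = card W \<and> (\<forall>w\<in>W. (r, w) \<in> A\<^sup>*)"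

lemma branching_insert:
  assumes "branching r W A" "finite W" "x \<in> W" "y \<notin> W"
  shows "branching r (insert y W) (insert (x, y) A)"
proof -
  have A: "A \<subseteq> W \<times> W" using assms by (simp add: branching_def)
  hence "finite A" "(x, y) \<notin> A" using assms finite_subset by auto
  moreover have "(r, w) \<in> (insert (x, y) A)\<^sup>*" if "w \<in> W" for w
    using assms that by (auto simp: branching_def intro: rtrancl_mono[THEN subsetD, rotated])
  moreover from this[of x] have "(r, y) \<in> (insert (x, y) A)\<^sup>*"
    using assms(3) by (auto intro: rtrancl_into_rtrancl)
  ultimately show ?thesis
    using assms A by (auto simp: branching_def)
qed

text \<open>
  The step of Lovasz's proof. Call a set avoiding \<open>r\<close> critical if it is not contained in \<open>W\<close> and exactly
  \<open>k\<close> arcs outside \<open>A\<close> enter it. An arc leaving \<open>W\<close> may be added if it enters no critical set. If there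
  are no critical sets, any arc leaving \<open>W\<close> will do. Otherwise, an inclusion-minimal critical set \<open>S\<close> yields one: more arcs enter \<open>S - W\<close> than \<open>S\<close>, so some arc runs from
  \<open>S \<inter> W\<close> to \<open>S - W\<close>. If it entered a critical set \<open>T\<close>, submodularity would make the
  smaller set \<open>S \<inter> T\<close> critical.
\<close>

lemma branching_extend_arc:
  assumes D: "finite V" "D \<subseteq> V \<times> V" and DK: "in_connected (Suc k) r V D"
    and A: "branching r W A" "A \<subseteq> D" "W \<subset> V" and AK: "in_connected k r V (D - A)"
  shows "\<exists>x y. x \<in> W \<and> y \<in> V - W \<and> (x, y) \<in> D \<and> in_connected k r V (D - insert (x, y) A)"
proof -
  have fin: "finite D" using D finite_subset by blast
  have AW: "A \<subseteq> W \<times> W" "r \<in> W" using A by (auto simp: branching_def)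
  have many: "Suc k \<le> card (in_arcs (D - A) S)" if "S \<subseteq> V - W" "S \<noteq> {}" for S
  proof -
    \<comment> \<open>The arcs of \<open>A\<close> have their heads in \<open>W\<close>, so removing them does not affect such an \<open>S\<close>.\<close>
    have "in_arcs (D - A) S = in_arcs D S"
      using AW that by (auto simp: in_arcs_def)
    moreover have "S \<subseteq> V - {r}" using AW that by auto
    ultimately show ?thesis using in_connectedD[OF DK] that by simp
  qed
  define crit where "crit = {S. S \<subseteq> V - {r} \<and> \<not> S \<subseteq> W \<and> card (in_arcs (D - A) S) = k}"
  have still: "in_connected k r V (D - insert (x, y) A)"
    if y: "y \<in> V - W" and no: "\<And>S. S \<in> crit \<Longrightarrow> y \<in> S \<Longrightarrow> x \<in> S" for x y
    unfolding in_connected_def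
  proof (intro allI impI)
    fix S assume S: "S \<subseteq> V - {r}" "S \<noteq> {}"
    have k: "k \<le> card (in_arcs (D - A) S)"
      using AK S by (auto simp: in_connected_def)
    have eq: "in_arcs (D - insert (x, y) A) S = in_arcs (D - A) S - {(x, y)}"
      by (auto simp: in_arcs_def)
    show "k \<le> card (in_arcs (D - insert (x, y) A) S)"
    proof (cases "(x, y) \<in> in_arcs (D - A) S")
      case True
      hence "x \<notin> S" "y \<in> S" by (auto simp: in_arcs_def)
      hence "S \<notin> crit" using no by auto
      hence "card (in_arcs (D - A) S) \<noteq> k" using S y \<open>y \<in> S\<close> by (auto simp: crit_def)
      thus ?thesis using k unfolding eq by (simp add: True fin finite_in_arcs card_Diff_singleton)
    qed (use k eq in simp)
  qed
  show ?thesis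
  proof (cases "crit = {}")
    case True
    have "Suc k \<le> card (in_arcs (D - A) (V - W))"
      using many[of "V - W"] A by auto
    hence "in_arcs (D - A) (V - W) \<noteq> {}" by (intro notI) simp
    then obtain x y where xy: "(x, y) \<in> D - A" "x \<notin> V - W" "y \<in> V - W"
      by (auto simp: in_arcs_def)
    moreover have "x \<in> W" using xy D by auto
    ultimately show ?thesis using still[of y x] True by blast
  next
    case False
    have "finite crit" by (rule finite_subset[of _ "Pow V"]) (auto simp: crit_def D)
    then obtain S where S: "S \<in> crit" and min: "\<And>T. T \<in> crit \<Longrightarrow> T \<subseteq> S \<Longrightarrow> S = T"
      using finite_has_minimal[OF _ False] by auto
    have Sk: "S \<subseteq> V - {r}" "S - W \<noteq> {}" "card (in_arcs (D - A) S) = k"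
      using S by (auto simp: crit_def)
    have "\<not> in_arcs (D - A) (S - W) \<subseteq> in_arcs (D - A) S"
    proof
      assume "in_arcs (D - A) (S - W) \<subseteq> in_arcs (D - A) S"
      hence "card (in_arcs (D - A) (S - W)) \<le> k"
        using fin Sk card_mono finite_in_arcs by (metis finite_Diff)
      moreover have "Suc k \<le> card (in_arcs (D - A) (S - W))"
        using Sk by (intro many) auto
      ultimately show False by simp
    qed
    then obtain x y where xy: "(x, y) \<in> D - A" "x \<in> S" "x \<in> W" "y \<in> S" "y \<notin> W"
      by (auto simp: in_arcs_def)
    have "x \<in> T" if T: "T \<in> crit" "y \<in> T" for T
    proof -
      have T': "T \<subseteq> V - {r}" "card (in_arcs (D - A) T) = k"
        using T by (auto simp: crit_def)
      have "k \<le> card (in_arcs (D - A) (S \<inter> T))" "k \<le> card (in_arcs (D - A) (S \<union> T))"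
        by (rule in_connectedD[OF AK], use Sk T' xy(4) T(2) in blast, use xy(4) T(2) in blast)+
      hence "card (in_arcs (D - A) (S \<inter> T)) = k"
        using in_arcs_submodular[of "D - A" S T] fin Sk T' by simp
      hence "S \<inter> T \<in> crit" using Sk xy T by (auto simp: crit_def)
      hence "S = S \<inter> T" by (intro min) auto
      thus ?thesis using xy by blast
    qed
    moreover have "y \<in> V - W" using xy Sk by auto
    ultimately show ?thesis using still[of y x] xy by blast
  qed
qed

lemma branching_peel:
  assumes D: "finite V" "D \<subseteq> V \<times> V" "r \<in> V" and DK: "in_connected (Suc k) r V D"
  shows "\<exists>A\<subseteq>D. branching r V A \<and> in_connected k r V (D - A)"
proof -
  have "\<exists>A\<subseteq>D. branching r V A \<and> in_connected k r V (D - A)"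
    if "branching r W A" "A \<subseteq> D" "W \<subseteq> V" "in_connected k r V (D - A)" for W A
    using that
  proof (induction "card (V - W)" arbitrary: W A)
    case 0
    hence "W = V" using D by auto
    thus ?case using 0 by blast
  next
    case (Suc m)
    have "W \<subset> V" using Suc.hyps(2) Suc.prems(3) by (cases "W = V") auto
    then obtain x y where xy: "x \<in> W" "y \<in> V - W" "(x, y) \<in> D"
        "in_connected k r V (D - insert (x, y) A)"
      using branching_extend_arc[OF D(1,2) DK Suc.prems(1,2) _ Suc.prems(4)] by blast
    have "V - insert y W = (V - W) - {y}" by auto
    hence m: "m = card (V - insert y W)"
      using Suc.hyps(2) card_Diff_singleton[OF xy(2)] by simp
    have br: "branching r (insert y W) (insert (x, y) A)"
      using xy Suc.prems(3) by (intro branching_insert Suc.prems(1) finite_subset[OF _ D(1)]) auto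
    have sub: "insert (x, y) A \<subseteq> D" "insert y W \<subseteq> V" using xy Suc.prems by auto
    show ?case by (rule Suc.hyps(1)[OF m br sub xy(4)])
  qed
  moreover have "branching r {r} {}" by (simp add: branching_def)
  moreover have "in_connected k r V (D - {})"
    using DK by (auto simp: in_connected_def dest: Suc_leD)
  ultimately show ?thesis using D(3) by blast
qed

text \<open>
  Edmonds' theorem on disjoint arborescences. Each peeled arborescence lowers the required
  number of entering arcs by only one.
\<close>

theorem Edmonds_branchings:
  assumes "finite V" "D \<subseteq> V \<times> V" "r \<in> V" and "in_connected k r V D"
  shows "\<exists>A. (\<forall>i<k. A i \<subseteq> D \<and> branching r V (A i)) \<and> disjoint_family_on A {..<k}"
  using assms(2,4)
proof (induction k arbitrary: D)
  case 0
  show ?case by (auto simp: disjoint_family_on_def)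
next
  case (Suc k)
  obtain B where B: "B \<subseteq> D" "branching r V B" "in_connected k r V (D - B)"
    using branching_peel[OF assms(1) Suc.prems(1) assms(3) Suc.prems(2)] by blast
  obtain A where A: "\<And>i. i < k \<Longrightarrow> A i \<subseteq> D - B \<and> branching r V (A i)"
      "disjoint_family_on A {..<k}"
    using Suc.IH[of "D - B"] B(3) Suc.prems(1) by blast
  have "disjoint_family_on (\<lambda>i. if i = k then B else A i) {..<Suc k}"
    unfolding disjoint_family_on_def
  proof (intro ballI impI)
    fix i j assume ij: "i \<in> {..<Suc k}" "j \<in> {..<Suc k}" "i \<noteq> j"
    have "A i \<inter> A j = {}" if "i < k" "j < k"
      using A(2) that ij(3) by (auto simp: disjoint_family_on_def)
    moreover have "A i \<inter> B = {}" if "i < k" for i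
      using A(1)[OF that] by blast
    ultimately show "(if i = k then B else A i) \<inter> (if j = k then B else A j) = {}"
      using ij by (auto simp: less_Suc_eq)
  qed
  moreover have "\<forall>i<Suc k. (if i = k then B else A i) \<subseteq> D \<and> branching r V (if i = k then B else A i)"
    using A(1) B(1,2) by (auto simp: less_Suc_eq)
  ultimately show ?case by (intro exI[of _ "\<lambda>i. if i = k then B else A i"] conjI)
qed

section \<open>Colorings from edge-disjoint spanning trees\<close>

lemma path_edges_snoc:
  "p \<noteq> [] \<Longrightarrow> path_edges (p @ [z]) = path_edges p @ [{last p, z}]"
  by (induction p rule: path_edges.induct) auto

lemma set_path_edges_append: "set (path_edges xs) \<subseteq> set (path_edges (xs @ ys))"
  by (induction xs rule: path_edges.induct) auto

lemma is_path_first_edge: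
  assumes "is_path E u v p" "u \<noteq> v"
  obtains y es where "path_edges p = {u, y} # es" "{u, y} \<in> E"
  using assms by (cases p rule: path_edges.cases) (auto simp: is_path_def)

definition adjacency :: "'a set set \<Rightarrow> ('a \<times> 'a) set" where
  "adjacency F = {(x, y). {x, y} \<in> F}"

lemma sym_adjacency: "sym (adjacency F)"
  by (auto simp: sym_def adjacency_def insert_commute)

text \<open>
  A walk is made into a path as it grows: on returning to a vertex already visited, cut back to it.
\<close>

lemma path_of_adjacency:
  assumes "(u, v) \<in> (adjacency F)\<^sup>*"
  shows "\<exists>p. is_path F u v p"
  using assms
proof (induction rule: rtrancl_induct)
  case base
  have "is_path F u u [u]" by (simp add: is_path_def)
  thus ?case ..
next
  case (step y z)
  then obtain p where p: "p \<noteq> []" "hd p = u" "last p = y" "distinct p" "set (path_edges p) \<subseteq> F"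
    by (auto simp: is_path_def)
  show ?case
  proof (cases "z \<in> set p")
    case True
    then obtain xs ys where "p = xs @ z # ys" by (auto dest: split_list)
    hence eq: "p = (xs @ [z]) @ ys" by simp
    have "set (path_edges (xs @ [z])) \<subseteq> F"
      using p(5) set_path_edges_append[of "xs @ [z]" ys] eq by auto
    moreover have "hd (xs @ [z]) = u" using p(2) eq by (cases xs) auto
    ultimately have "is_path F u z (xs @ [z])" using p(4) eq by (auto simp: is_path_def)
    thus ?thesis ..
  next
    case False
    hence "is_path F u z (p @ [z])"
      using p step(2) by (auto simp: is_path_def path_edges_snoc adjacency_def)
    thus ?thesis ..
  qed
qed

text \<open>
  These make the maximum in the definition of \<open>rmc\<close> a maximum of a finite set.
\<close>

lemma rmc_color_counts:
  assumes "finite E"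
  shows "finite {card (col ` E) | col. rmc_coloring k V E col}"
    and "n \<in> {card (col ` E) | col. rmc_coloring k V E col} \<Longrightarrow> n \<le> card E"
proof -
  have "{card (col ` E) | col. rmc_coloring k V E col} \<subseteq> {..card E}"
    using assms by (auto intro: card_image_le)
  thus "finite {card (col ` E) | col. rmc_coloring k V E col}"
    "n \<in> {card (col ` E) | col. rmc_coloring k V E col} \<Longrightarrow> n \<le> card E"
    using finite_subset by auto
qed

lemma rmc_at_least_card:
  assumes "finite E" "rmc_at_least k V r E"
  shows "r \<le> real (card E)"
proof -
  have "rmc k V E \<in> {card (col ` E) | col. rmc_coloring k V E col}"
    unfolding rmc_def using assms
    by (intro Max_in rmc_color_counts) (auto simp: rmc_at_least_def)
  hence "rmc k V E \<le> card E" by (rule rmc_color_counts(2)[OF assms(1)])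
  thus ?thesis using assms(2) by (simp add: rmc_at_least_def)
qed

lemma rmc_at_leastI:
  assumes "finite E" "rmc_coloring k V E col" "r \<le> real (card (col ` E))"
  shows "rmc_at_least k V r E"
proof -
  have "card (col ` E) \<le> rmc k V E"
    unfolding rmc_def using assms by (intro Max_ge rmc_color_counts) auto
  thus ?thesis using assms by (auto simp: rmc_at_least_def)
qed

lemma rmc_at_least_no_isolated:
  assumes "rmc_at_least k V r E" "k \<ge> 1" "v \<in> V" "u \<in> V" "u \<noteq> v"
  shows "\<exists>e\<in>E. v \<in> e"
proof -
  obtain col where "rmc_coloring k V E col" using assms(1) by (auto simp: rmc_at_least_def)
  then obtain P where P: "k \<le> card P" "rainbow_mono_paths E col v u P"
    using assms unfolding rmc_coloring_def by metis
  hence "P \<noteq> {}" using assms(2) by auto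
  then obtain p where "is_path E v u p" using P by (auto simp: rainbow_mono_paths_def)
  thus ?thesis using assms(5) by (elim is_path_first_edge) auto
qed

text \<open>
  Give color \<open>i\<close> to the \<open>i\<close>-th of the first \<open>k\<close> connected subgraphs and a private color to every
  other edge. Each of the \<open>k\<close> subgraphs contributes one monochromatic path between any two vertices,
  and the remaining \<open>K - k\<close> subgraphs alone contain \<open>(K - k) * m\<close> edges of different colors. In this
  way one packing provides both the paths and the colors.
\<close>

lemma rmc_at_least_of_packing:
  fixes F :: "nat \<Rightarrow> 'a set set"
  assumes E: "finite E" and FE: "\<And>i. i < K \<Longrightarrow> F i \<subseteq> E" and disj: "disjoint_family_on F {..<K}"
    and size: "\<And>i. i < K \<Longrightarrow> card (F i) = m"
    and conn: "\<And>i u v. i < K \<Longrightarrow> u \<in> V \<Longrightarrow> v \<in> V \<Longrightarrow> (u, v) \<in> (adjacency (F i))\<^sup>*"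
    and "k \<le> K" and r: "r \<le> real (K - k) * real m"
  shows "rmc_at_least k V r E"
proof -
  obtain g :: "'a set \<Rightarrow> nat" where g: "inj_on g E"
    using finite_imp_inj_to_nat_seg[OF E] by auto
  define col where "col e = (if \<exists>i<k. e \<in> F i then (LEAST i. e \<in> F i) else k + g e)" for e
  have uniq: "i = j" if "i < K" "j < K" "e \<in> F i" "e \<in> F j" for i j e
    using disj that by (auto simp: disjoint_family_on_def)
  have col_F: "col e = i" if "i < k" "e \<in> F i" for i e
  proof -
    have "(LEAST i. e \<in> F i) = i"
    proof (rule Least_equality)
      fix j assume "e \<in> F j"
      thus "i \<le> j" using uniq[of i j e] that \<open>k \<le> K\<close> by (cases "j < K") auto
    qed (rule that)
    thus ?thesis using that by (auto simp: col_def)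
  qed
  have "rmc_coloring k V E col"
    unfolding rmc_coloring_def
  proof (intro ballI impI)
    fix u v assume uv: "u \<in> V" "v \<in> V" "u \<noteq> v"
    have "\<forall>i\<in>{..<k}. \<exists>p. is_path (F i) u v p"
      using conn uv \<open>k \<le> K\<close> path_of_adjacency by (metis lessThan_iff less_le_trans)
    then obtain p where p: "\<And>i. i < k \<Longrightarrow> is_path (F i) u v (p i)" by (metis lessThan_iff)
    have col_p: "col e = i" if "i < k" "e \<in> set (path_edges (p i))" for i e
      using p[OF that(1)] that by (intro col_F) (auto simp: is_path_def)
    have pc: "path_color col (p i) = i" if i: "i < k" for i
    proof -
      obtain y es where "path_edges (p i) = {u, y} # es"
        using is_path_first_edge[OF p[OF i] uv(3)] .
      thus ?thesis using col_p[OF i, of "{u, y}"] by (simp add: path_color_def)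
    qed
    have "rainbow_mono_paths E col u v (p ` {..<k})"
      unfolding rainbow_mono_paths_def
    proof (intro conjI)
      show "\<forall>q\<in>p ` {..<k}. is_path E u v q \<and> monochromatic col q"
      proof (intro ballI)
        fix q assume "q \<in> p ` {..<k}"
        then obtain i where i: "i < k" "q = p i" by auto
        have "is_path E u v q" using p[OF i(1)] FE[of i] i \<open>k \<le> K\<close> by (auto simp: is_path_def)
        moreover have "monochromatic col q"
          using col_p[OF i(1)] i(2) by (auto simp: monochromatic_def)
        ultimately show "is_path E u v q \<and> monochromatic col q" ..
      qed
      have "disjnt (set (path_edges (p i))) (set (path_edges (p j))) \<and>
          path_color col (p i) \<noteq> path_color col (p j)" if "i < k" "j < k" "p i \<noteq> p j" for i j
        using pc that col_p unfolding disjnt_iff by metis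
      thus "pairwise (\<lambda>p q. disjnt (set (path_edges p)) (set (path_edges q)) \<and>
                     path_color col p \<noteq> path_color col q) (p ` {..<k})"
        by (auto simp: pairwise_def)
    qed
    moreover have "inj_on p {..<k}" using pc by (intro inj_onI) (metis lessThan_iff)
    hence "card (p ` {..<k}) = k" by (simp add: card_image)
    ultimately show "\<exists>P. finite P \<and> k \<le> card P \<and> rainbow_mono_paths E col u v P"
      by (intro exI[of _ "p ` {..<k}"]) auto
  qed
  moreover have "r \<le> real (card (col ` E))"
  proof -
    define R where "R = (\<Union>i\<in>{k..<K}. F i)"
    have R: "R \<subseteq> E" unfolding R_def using FE by (meson UN_least atLeastLessThan_iff)
    have fresh: "\<not> (\<exists>i<k. e \<in> F i)" if "e \<in> R" for e
      using that uniq \<open>k \<le> K\<close> unfolding R_def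
      by (metis UN_E atLeastLessThan_iff less_le_trans not_le)
    have "col e = k + g e" if "e \<in> R" for e
      unfolding col_def by (rule if_not_P[OF fresh[OF that]])
    hence "inj_on col R" using g R by (auto simp: inj_on_def)
    hence "card R = card (col ` R)" by (simp add: card_image)
    also have "\<dots> \<le> card (col ` E)" using E R by (intro card_mono) auto
    finally have "card R \<le> card (col ` E)" .
    moreover have "card R = (\<Sum>i\<in>{k..<K}. card (F i))"
      unfolding R_def using uniq finite_subset[OF FE E] by (intro card_UN_disjoint) auto
    hence "card R = (K - k) * m" using size by simp
    ultimately have "real (K - k) * real m \<le> real (card (col ` E))"
      by (metis of_nat_le_iff of_nat_mult)
    thus ?thesis using r by linarith
  qed
  ultimately show ?thesis by (rule rmc_at_leastI[OF E])
qed

text \<open>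
  Each edge gets at most one direction, so arc-disjoint arborescences become edge-disjoint trees.
\<close>

definition orientation :: "'a set \<Rightarrow> ('a \<times> 'a) set \<Rightarrow> bool" where
  "orientation V T \<longleftrightarrow> T \<subseteq> V \<times> V \<and> (\<forall>u v. (u, v) \<in> T \<longrightarrow> (v, u) \<notin> T)"

abbreviation underlying :: "('a \<times> 'a) set \<Rightarrow> 'a set set" where
  "underlying D \<equiv> (\<lambda>(u, v). {u, v}) ` D"

lemma inj_on_underlying: "orientation V T \<Longrightarrow> inj_on (\<lambda>(u, v). {u, v}) T"
  by (auto simp: orientation_def inj_on_def doubleton_eq_iff)

text \<open>
  Orient the edges of the graph along \<open>T\<close> and apply Edmonds' theorem. The orientation replaces
  the theorem of Nash-Williams and Tutte, whose hypothesis concerns undirected cuts.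
\<close>

lemma rmc_at_least_of_in_cuts:
  assumes V: "finite V" "r \<in> V" and E: "E \<subseteq> nsets V 2" and T: "orientation V T"
    and cuts: "\<And>S. S \<subseteq> V - {r} \<Longrightarrow> S \<noteq> {} \<Longrightarrow> K \<le> card (E \<inter> underlying (in_arcs T S))"
    and "k \<le> K" and f: "f \<le> real (K - k) * (real (card V) - 1)"
  shows "rmc_at_least k V f E"
proof -
  define D where "D = {(u, v) \<in> T. {u, v} \<in> E}"
  have D: "D \<subseteq> V \<times> V" "finite D"
    using T V by (auto simp: D_def orientation_def intro: finite_subset[of _ "V \<times> V"])
  have finE: "finite E" using E V finite_imp_finite_nsets finite_subset by blast
  have "in_connected K r V D"
    unfolding in_connected_def
  proof (intro allI impI)
    fix S assume "S \<subseteq> V - {r}" "S \<noteq> {}"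
    hence "K \<le> card (E \<inter> underlying (in_arcs T S))" by (rule cuts)
    also have "\<dots> \<le> card (underlying (in_arcs D S))"
      using finite_in_arcs[OF D(2), of S] by (intro card_mono) (auto simp: D_def in_arcs_def)
    also have "\<dots> \<le> card (in_arcs D S)"
      using finite_in_arcs[OF D(2)] by (rule card_image_le)
    finally show "K \<le> card (in_arcs D S)" .
  qed
  then obtain A where A: "\<And>i. i < K \<Longrightarrow> A i \<subseteq> D \<and> branching r V (A i)"
      and disj: "disjoint_family_on A {..<K}"
    using Edmonds_branchings[OF V(1) D(1) V(2)] by blast
  have inj: "inj_on (\<lambda>(u, v). {u, v}) D"
    by (rule inj_on_subset[OF inj_on_underlying[OF T]]) (auto simp: D_def)
  show ?thesis
  proof (rule rmc_at_least_of_packing[where F = "\<lambda>i. underlying (A i)" and m = "card V - 1"])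
    fix i assume i: "i < K"
    show "underlying (A i) \<subseteq> E" using A[OF i] by (auto simp: D_def)
    have "card (underlying (A i)) = card (A i)"
      using A[OF i] by (intro card_image inj_on_subset[OF inj]) auto
    thus "card (underlying (A i)) = card V - 1" using A[OF i] by (auto simp: branching_def)
    have root: "(r, v) \<in> (adjacency (underlying (A i)))\<^sup>*" if "v \<in> V" for v
    proof -
      have "A i \<subseteq> adjacency (underlying (A i))" by (force simp: adjacency_def)
      hence "(A i)\<^sup>* \<subseteq> (adjacency (underlying (A i)))\<^sup>*" by (rule rtrancl_mono)
      thus ?thesis using A[OF i] that by (auto simp: branching_def)
    qed
    fix u v assume uv: "u \<in> V" "v \<in> V"
    have "(u, r) \<in> (adjacency (underlying (A i)))\<^sup>*"
      by (rule symD[OF sym_rtrancl[OF sym_adjacency] root[OF uv(1)]])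
    also have "(r, v) \<in> (adjacency (underlying (A i)))\<^sup>*" by (rule root[OF uv(2)])
    finally show "(u, v) \<in> (adjacency (underlying (A i)))\<^sup>*" .
  next
    show "disjoint_family_on (\<lambda>i. underlying (A i)) {..<K}"
      unfolding disjoint_family_on_def
    proof (intro ballI impI)
      fix i j assume ij: "i \<in> {..<K}" "j \<in> {..<K}" "i \<noteq> j"
      have "underlying (A i) \<inter> underlying (A j) = underlying (A i \<inter> A j)"
        using A ij by (intro inj_on_image_Int[OF inj, symmetric]) auto
      also have "A i \<inter> A j = {}" using disj ij by (auto simp: disjoint_family_on_def)
      finally show "underlying (A i) \<inter> underlying (A j) = {}" by simp
    qed
    have "card V \<ge> 1" using V by (metis One_nat_def Suc_leI card_gt_0_iff empty_iff)
    thus "f \<le> real (K - k) * real (card V - 1)" using f by (simp add: of_nat_diff)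
  qed (use finE \<open>k \<le> K\<close> in auto)
qed

section \<open>A balanced orientation of the complete graph\<close>

text \<open>
  Of the at least \<open>h * card S\<close> arcs with head in \<open>S\<close>, at most \<open>card S choose 2\<close> have their tail in
  \<open>S\<close> too. The inequality is multiplied by two and arranged to avoid subtraction.
\<close>

lemma in_arcs_lower_bound:
  assumes V: "finite V" and T: "orientation V T" and S: "S \<subseteq> V"
    and deg: "\<And>v. v \<in> S \<Longrightarrow> h \<le> card {u. (u, v) \<in> T}"
  shows "2 * h * card S + card S \<le> 2 * card (in_arcs T S) + card S * card S"
proof -
  have fin: "finite S" "finite T"
    using V S T finite_subset[of T "V \<times> V"] by (auto simp: orientation_def intro: finite_subset)
  \<comment> \<open>The arcs inside \<open>S\<close>: they, their reversals and the diagonal are disjoint subsets of \<open>S \<times> S\<close>.\<close>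
  define I where "I = T \<inter> S \<times> S"
  have I: "finite I" using fin by (simp add: I_def)
  have finv: "finite {u. (u, v) \<in> T}" for v
    by (rule finite_subset[of _ "fst ` T"]) (use fin in force)+
  have "h * card S = (\<Sum>v\<in>S. h)" by simp
  also have "\<dots> \<le> (\<Sum>v\<in>S. card {u. (u, v) \<in> T})" by (intro sum_mono deg)
  also have "\<dots> = card (SIGMA v:S. {u. (u, v) \<in> T})"
    using fin finv by (intro card_SigmaI[symmetric]) auto
  also have "\<dots> = card (in_arcs T S \<union> I)"
  proof (rule bij_betw_same_card[of prod.swap])
    show "bij_betw prod.swap (SIGMA v:S. {u. (u, v) \<in> T}) (in_arcs T S \<union> I)"
      by (rule bij_betwI[where g = prod.swap]) (auto simp: in_arcs_def I_def)
  qed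
  also have "\<dots> = card (in_arcs T S) + card I"
    using fin I by (intro card_Un_disjoint finite_in_arcs) (auto simp: in_arcs_def I_def)
  finally have 1: "h * card S \<le> card (in_arcs T S) + card I" .
  have "card I + card I + card S = card I + card (I\<inverse>) + card ((\<lambda>v. (v, v)) ` S)"
    by (simp add: card_inverse card_image inj_on_def)
  also have "card I + card (I\<inverse>) = card (I \<union> I\<inverse>)"
    using I T by (intro card_Un_disjoint[symmetric]) (auto simp: I_def orientation_def)
  also have "\<dots> + card ((\<lambda>v. (v, v)) ` S) = card (I \<union> I\<inverse> \<union> (\<lambda>v. (v, v)) ` S)"
    using I T fin by (intro card_Un_disjoint[symmetric]) (auto simp: I_def orientation_def)
  also have "\<dots> \<le> card (S \<times> S)"
    using fin by (intro card_mono) (auto simp: I_def)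
  finally have "2 * card I + card S \<le> card S * card S"
    by (simp add: card_cartesian_product)
  thus ?thesis using 1 by simp
qed

text \<open>
  The rotational tournament: place the vertices on a circle and direct every pair along its shorter
  arc. For even \<open>n\<close> antipodal pairs stay undirected.
\<close>

definition rotation :: "nat \<Rightarrow> (nat \<times> nat) set" where
  "rotation n = {(u, (u + j) mod n) | u j. u < n \<and> j \<in> {1..(n - 1) div 2}}"

lemma mod_neq_of_close:
  fixes a b n :: nat
  assumes "a < b" "b < a + n"
  shows "a mod n \<noteq> b mod n"
proof
  assume "a mod n = b mod n"
  hence "n dvd b - a" using assms by (metis less_imp_le mod_eq_dvd_iff_nat)
  thus False using assms by (auto dest: dvd_imp_le)
qed

lemma orientation_rotation: "orientation {..<n} (rotation n)"
proof -
  have "(v, u) \<notin> rotation n" if "(u, v) \<in> rotation n" for u v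
  proof
    assume "(v, u) \<in> rotation n"
    then obtain i where i: "u = (v + i) mod n" "i \<in> {1..(n - 1) div 2}" by (auto simp: rotation_def)
    from that obtain j where j: "v = (u + j) mod n" "j \<in> {1..(n - 1) div 2}" "u < n"
      by (auto simp: rotation_def)
    have "u mod n = (u + (j + i)) mod n"
      using i(1) j(1,3) by (metis add.assoc mod_add_left_eq mod_less)
    moreover have "u < u + (j + i)" "u + (j + i) < u + n" using i(2) j(2,3) by auto
    ultimately show False using mod_neq_of_close by blast
  qed
  thus ?thesis by (auto simp: orientation_def rotation_def)
qed

lemma rotation_outdegree:
  assumes "u < n"
  shows "(n - 1) div 2 \<le> card {v. (u, v) \<in> rotation n}"
proof -
  have "inj_on (\<lambda>j. (u + j) mod n) {1..(n - 1) div 2}"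
  proof (rule linorder_inj_onI)
    fix i j assume "i < j" "i \<in> {1..(n - 1) div 2}" "j \<in> {1..(n - 1) div 2}"
    thus "(u + i) mod n \<noteq> (u + j) mod n" by (intro mod_neq_of_close) auto
  qed auto
  hence "(n - 1) div 2 = card ((\<lambda>j. (u + j) mod n) ` {1..(n - 1) div 2})"
    by (simp add: card_image)
  also have "\<dots> \<le> card {v. (u, v) \<in> rotation n}"
    using assms by (intro card_mono) (auto simp: rotation_def intro: finite_subset[of _ "{..<n}"])
  finally show ?thesis .
qed

lemma rotation_indegree:
  assumes "v < n"
  shows "(n - 1) div 2 \<le> card {u. (u, v) \<in> rotation n}"
proof -
  let ?f = "\<lambda>j. (v + (n - j)) mod n"
  have "inj_on ?f {1..(n - 1) div 2}"
  proof (rule linorder_inj_onI)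
    fix i j assume "i < j" "i \<in> {1..(n - 1) div 2}" "j \<in> {1..(n - 1) div 2}"
    thus "?f i \<noteq> ?f j" by (intro mod_neq_of_close[THEN not_sym]) auto
  qed auto
  hence "(n - 1) div 2 = card (?f ` {1..(n - 1) div 2})"
    by (simp add: card_image)
  also have "\<dots> \<le> card {u. (u, v) \<in> rotation n}"
  proof (intro card_mono)
    show "finite {u. (u, v) \<in> rotation n}"
      by (rule finite_subset[of _ "{..<n}"]) (auto simp: rotation_def)
    show "?f ` {1..(n - 1) div 2} \<subseteq> {u. (u, v) \<in> rotation n}"
    proof safe
      fix j assume j: "j \<in> {1..(n - 1) div 2}"
      have "((v + (n - j)) mod n + j) mod n = (v + (n - j) + j) mod n"
        by (rule mod_add_left_eq)
      also have "v + (n - j) + j = v + n" using j by auto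
      also have "(v + n) mod n = v" using assms by simp
      finally have "v = (?f j + j) mod n" ..
      moreover have "?f j < n" using assms by simp
      ultimately show "(?f j, v) \<in> rotation n" using j unfolding rotation_def by blast
    qed
  qed
  finally show ?thesis .
qed

text \<open>
  The second bound counts the arcs leaving the complement: it is the first bound for the reversed
  orientation.
\<close>

lemma rotation_cut_count:
  assumes S: "S \<subseteq> {..<n}"
  defines "h \<equiv> (n - 1) div 2" and "a \<equiv> card (underlying (in_arcs (rotation n) S))"
  shows "2 * h * card S + card S \<le> 2 * a + card S * card S"
    and "2 * h * card ({..<n} - S) + card ({..<n} - S)
      \<le> 2 * a + card ({..<n} - S) * card ({..<n} - S)"
proof -
  let ?T = "rotation n" and ?S = "{..<n} - S"
  have deg: "h \<le> card {u. (u, v) \<in> ?T}" "h \<le> card {u. (v, u) \<in> ?T}" if "v < n" for v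
    unfolding h_def using that by (rule rotation_indegree rotation_outdegree)+
  have a: "a = card (in_arcs ?T S)"
    unfolding a_def
    by (intro card_image inj_on_subset[OF inj_on_underlying[OF orientation_rotation]])
      (auto simp: in_arcs_def)
  show "2 * h * card S + card S \<le> 2 * a + card S * card S"
    unfolding a using S by (intro in_arcs_lower_bound[OF _ orientation_rotation]) (auto intro: deg)
  have "orientation {..<n} (?T\<inverse>)" using orientation_rotation[of n] by (auto simp: orientation_def)
  hence "2 * h * card ?S + card ?S \<le> 2 * card (in_arcs (?T\<inverse>) ?S) + card ?S * card ?S"
    by (intro in_arcs_lower_bound[of "{..<n}"]) (auto intro: deg)
  moreover have "in_arcs (?T\<inverse>) ?S = (in_arcs ?T S)\<inverse>"
    using S orientation_rotation[of n] by (auto simp: in_arcs_def orientation_def)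
  ultimately show "2 * h * card ?S + card ?S \<le> 2 * a + card ?S * card ?S"
    unfolding a by (simp add: card_inverse)
qed

text \<open>
  Both counts together show that each cut carries a constant fraction of its pairs in either
  direction: the cut between \<open>s \<le> n / 2\<close> vertices and the others has at most \<open>s * n\<close> pairs.
\<close>

lemma rotation_cut:
  assumes "n \<ge> 4" "S \<subseteq> {..<n}"
  shows "real (min (card S) (card ({..<n} - S))) * real n / 8
    \<le> real (card (underlying (in_arcs (rotation n) S)))"
proof -
  define h where "h = (n - 1) div 2"
  have h: "real n - 2 \<le> 2 * real h" unfolding h_def using assms(1) by linarith
  have arith: "real s * real n / 8 \<le> real a"
    if "2 * h * s + s \<le> 2 * a + s * s" "2 * s \<le> n" for s a :: nat
  proof -
    have "real (2 * h * s + s) \<le> real (2 * a + s * s)" using that(1) by (rule of_nat_mono)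
    hence "real s * (2 * real h + 1 - real s) \<le> 2 * real a" by (simp add: algebra_simps)
    moreover have "real s * (real n / 4) \<le> real s * (2 * real h + 1 - real s)"
      using h that(2) assms(1) by (intro mult_left_mono) linarith+
    ultimately show ?thesis by simp
  qed
  have compl: "card ({..<n} - S) = n - card S" "card S \<le> n"
    using assms(2) card_mono[OF _ assms(2)] by (auto simp: card_Diff_subset finite_subset)
  show ?thesis
  proof (cases "2 * card S \<le> n")
    case True
    hence "min (card S) (card ({..<n} - S)) = card S" using compl by linarith
    thus ?thesis
      using arith[OF rotation_cut_count(1)[OF assms(2), folded h_def] True] by simp
  next
    case False
    hence "min (card S) (card ({..<n} - S)) = card ({..<n} - S)" "2 * card ({..<n} - S) \<le> n"
      using compl by linarith+
    thus ?thesis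
      using arith[OF rotation_cut_count(2)[OF assms(2), folded h_def]] by simp
  qed
qed

text \<open>
  Every in-cut of \<open>rotation n\<close> has at least \<open>(n - 1) div 2\<close> arcs: with \<open>h = (n - 1) div 2\<close> the bound
  \<open>s * (2 * h + 1 - s) / 2\<close> is concave in \<open>s\<close> and equals \<open>h\<close> at both \<open>s = 1\<close> and \<open>s = 2 * h\<close>. The only
  other size, \<open>s = n - 1\<close> for even \<open>n\<close>, is handled by the out-degree of the missing vertex.
\<close>

lemma rmc_coloring_complete_graph:
  assumes "k < n div 2"
  shows "\<exists>col. rmc_coloring k {..<n} (nsets {..<n} 2) col"
proof -
  define h where "h = (n - 1) div 2"
  have h: "k \<le> h" "n \<le> 2 * h + 2" using assms by (auto simp: h_def)
  have "rmc_at_least k {..<n} 0 (nsets {..<n} 2)"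
  proof (rule rmc_at_least_of_in_cuts[OF _ _ _ orientation_rotation])
    fix S assume S: "S \<subseteq> {..<n} - {0}" "S \<noteq> {}"
    define a where "a = card (underlying (in_arcs (rotation n) S))"
    define s where "s = card S"
    have Sn: "S \<subseteq> {..<n}" using S by auto
    have fin: "finite S" by (rule finite_subset[OF Sn]) simp
    hence "s > 0" using S(2) by (simp add: s_def card_gt_0_iff)
    have "s \<le> card ({..<n} - {0})" unfolding s_def using S by (intro card_mono) auto
    hence sn: "s \<le> n - 1" using assms by simp
    have "h \<le> a"
    proof (cases "s \<le> 2 * h")
      case True
      have "2 * h * s + s \<le> 2 * a + s * s"
        using rotation_cut_count(1)[OF Sn] by (simp add: s_def a_def h_def)
      \<comment> \<open>This is \<open>(s - 1) * (2 * h - s) \<ge> 0\<close>.\<close>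
      moreover have "(s - 1) * s + 2 * h \<le> (s - 1) * (2 * h) + 2 * h"
        using True by (intro add_mono mult_left_mono) auto
      hence "s * s + 2 * h \<le> 2 * h * s + s"
        using \<open>s > 0\<close> by (cases s) (simp_all add: algebra_simps)
      ultimately show ?thesis by linarith
    next
      case False
      hence "s = n - 1" using sn h(2) by linarith
      hence "card ({..<n} - S) = 1"
        using assms Sn fin by (simp add: card_Diff_subset s_def)
      thus ?thesis using rotation_cut_count(2)[OF Sn] by (simp add: a_def h_def)
    qed
    moreover have "nsets {..<n} 2 \<inter> underlying (in_arcs (rotation n) S) = underlying (in_arcs (rotation n) S)"
      using orientation_rotation[of n] by (auto simp: in_arcs_def orientation_def)
    ultimately show "k \<le> card (nsets {..<n} 2 \<inter> underlying (in_arcs (rotation n) S))"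
      using h(1) by (simp add: a_def)
  qed (use assms in auto)
  thus ?thesis by (simp add: rmc_at_least_def)
qed

section \<open>Edge counts in the random graph\<close>

lemma set_random_graph: "E \<in> set_pmf (random_graph n q) \<Longrightarrow> E \<subseteq> nsets {..<n} 2"
  by (auto simp: random_graph_def)

lemma integrable_random_graph: "integrable (random_graph n q) (g :: _ \<Rightarrow> real)"
proof -
  have "set_pmf (random_graph n q) \<subseteq> Pow (nsets {..<n} 2)"
    using set_random_graph by blast
  hence "finite (set_pmf (random_graph n q))"
    by (rule finite_subset) (simp add: finite_imp_finite_nsets)
  thus ?thesis by (rule integrable_measure_pmf_finite)
qed

text \<open>
  Markov's inequality for an event dominated by \<open>g\<close>.
\<close>

lemma prob_random_graph_le:
  fixes g :: "nat set set \<Rightarrow> real"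
  assumes "\<And>E. E \<subseteq> nsets {..<n} 2 \<Longrightarrow> Q E \<Longrightarrow> 1 \<le> g E" and "\<And>E. 0 \<le> g E"
  shows "measure_pmf.prob (random_graph n q) {E. Q E} \<le> measure_pmf.expectation (random_graph n q) g"
proof -
  have "measure_pmf.prob (random_graph n q) {E. Q E}
      = measure_pmf.expectation (random_graph n q) (indicator {E. Q E})" by simp
  also have "\<dots> \<le> measure_pmf.expectation (random_graph n q) g"
    using assms set_random_graph
    by (intro integral_mono_AE integrable_random_graph) (auto simp: AE_measure_pmf_iff indicator_def)
  finally show ?thesis .
qed

text \<open>
  The generating function of a binomial variable. All probability estimates come from
  it: \<open>z = 1 / 2\<close> and \<open>z = 2\<close> give the exponential tail bounds below, \<open>z = 0\<close> the probability that
  no edge of \<open>B\<close> is present.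
\<close>

lemma expectation_power_card:
  fixes z :: real
  assumes q: "q \<in> {0..1}" and B: "B \<subseteq> nsets {..<n} 2" and z: "0 \<le> z"
  shows "measure_pmf.expectation (random_graph n q) (\<lambda>E. z ^ card (E \<inter> B)) = (1 - q + q * z) ^ card B"
proof -
  let ?N = "nsets {..<n} 2" and ?g = "\<lambda>e b. if e \<in> B \<and> b then z else 1"
  have N: "finite ?N" by (simp add: finite_imp_finite_nsets)
  have pw: "z ^ card ({e \<in> ?N. present e} \<inter> B) = (\<Prod>e\<in>?N. ?g e (present e))" for present
  proof -
    have "{e \<in> ?N. present e} \<inter> B = ?N \<inter> {e. e \<in> B \<and> present e}" by auto
    thus ?thesis using N by (simp add: prod.If_cases)
  qed
  have "measure_pmf.expectation (random_graph n q) (\<lambda>E. z ^ card (E \<inter> B))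
      = measure_pmf.expectation (Pi_pmf ?N False (\<lambda>_. bernoulli_pmf q)) (\<lambda>h. \<Prod>e\<in>?N. ?g e (h e))"
    unfolding random_graph_def integral_map_pmf pw ..
  also have "\<dots> = (\<Prod>e\<in>?N. measure_pmf.expectation (bernoulli_pmf q) (?g e))"
    using N z by (intro expectation_prod_Pi_pmf integrable_measure_pmf_finite) auto
  also have "\<dots> = (\<Prod>e\<in>?N. if e \<in> B then 1 - q + q * z else 1)"
    using q by (intro prod.cong) auto
  also have "\<dots> = (1 - q + q * z) ^ card (?N \<inter> B)"
    using N by (simp add: prod.If_cases)
  also have "?N \<inter> B = B" using B by auto
  finally show ?thesis .
qed

lemma prob_few_edges:
  assumes q: "q \<in> {0..1}" and B: "B \<subseteq> nsets {..<n} 2"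
  shows "measure_pmf.prob (random_graph n q) {E. real (card (E \<inter> B)) \<le> t}
    \<le> exp (t - q * real (card B) / 2)"
proof -
  have "measure_pmf.prob (random_graph n q) {E. real (card (E \<inter> B)) \<le> t}
      \<le> measure_pmf.expectation (random_graph n q) (\<lambda>E. exp t * (1 / 2) ^ card (E \<inter> B))"
  proof (rule prob_random_graph_le)
    fix E assume "real (card (E \<inter> B)) \<le> t"
    hence "exp (real (card (E \<inter> B)) * 1) \<le> exp t" by simp
    hence "exp 1 ^ card (E \<inter> B) \<le> exp t" by (simp only: exp_of_nat_mult)
    moreover have "(2::real) ^ card (E \<inter> B) \<le> exp 1 ^ card (E \<inter> B)"
      using exp_ge_add_one_self[of 1] by (intro power_mono) auto
    ultimately show "1 \<le> exp t * (1 / 2) ^ card (E \<inter> B)"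
      by (simp add: power_one_over field_simps)
  qed auto
  also have "\<dots> = exp t * (1 - q + q * (1 / 2)) ^ card B"
    by (subst Bochner_Integration.integral_mult_right_zero, subst expectation_power_card[OF q B]) auto
  also have "(1 - q + q * (1 / 2)) ^ card B \<le> exp (- (q / 2)) ^ card B"
    using q exp_ge_add_one_self[of "- (q / 2)"] by (intro power_mono) auto
  also have "exp (- (q / 2)) ^ card B = exp (- q * real (card B) / 2)"
    by (simp flip: exp_of_nat_mult add: field_simps)
  also have "exp t * exp (- q * real (card B) / 2) = exp (t - q * real (card B) / 2)"
    by (simp flip: exp_add)
  finally show ?thesis by simp
qed

lemma prob_many_edges:
  assumes q: "q \<in> {0..1}" and B: "B \<subseteq> nsets {..<n} 2"
  shows "measure_pmf.prob (random_graph n q) {E. t \<le> real (card (E \<inter> B))}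
    \<le> exp (q * real (card B) - t / 2)"
proof -
  have "measure_pmf.prob (random_graph n q) {E. t \<le> real (card (E \<inter> B))}
      \<le> measure_pmf.expectation (random_graph n q) (\<lambda>E. exp (- t / 2) * 2 ^ card (E \<inter> B))"
  proof (rule prob_random_graph_le)
    fix E assume t: "t \<le> real (card (E \<inter> B))"
    have "exp (t / 2) \<le> exp (real (card (E \<inter> B)) * (1 / 2))" using t by simp
    also have "\<dots> = exp (1 / 2) ^ card (E \<inter> B)" by (rule exp_of_nat_mult)
    also have "exp (1 / 2) \<le> exp (ln (2::real))" using ln2_ge_two_thirds by (subst exp_le_cancel_iff) linarith
    hence "exp (1 / 2) ^ card (E \<inter> B) \<le> (2::real) ^ card (E \<inter> B)" by (intro power_mono) auto
    finally show "1 \<le> exp (- t / 2) * 2 ^ card (E \<inter> B)"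
      by (simp add: exp_minus field_simps)
  qed auto
  also have "\<dots> = exp (- t / 2) * (1 - q + q * 2) ^ card B"
    by (subst Bochner_Integration.integral_mult_right_zero, subst expectation_power_card[OF q B]) auto
  also have "(1 - q + q * 2) ^ card B \<le> exp q ^ card B"
    using q exp_ge_add_one_self[of q] by (intro power_mono) (auto simp: add.commute)
  also have "exp q ^ card B = exp (q * real (card B))"
    by (simp flip: exp_of_nat_mult add: field_simps)
  also have "exp (- t / 2) * exp (q * real (card B)) = exp (q * real (card B) - t / 2)"
    by (simp flip: exp_add)
  finally show ?thesis by simp
qed

section \<open>Isolated vertices\<close>

text \<open>
  A vertex \<open>v\<close> is isolated in \<open>E\<close> iff \<open>E \<inter> star n v = {}\<close>.
\<close>

definition star :: "nat \<Rightarrow> nat \<Rightarrow> nat set set" where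
  "star n v = {e \<in> nsets {..<n} 2. v \<in> e}"

lemma card_star:
  assumes "v < n"
  shows "card (star n v) = n - 1"
proof -
  have "star n v = (\<lambda>u. {v, u}) ` ({..<n} - {v})"
    using assms unfolding star_def by (auto simp: nsets_2_eq insert_commute)
  moreover have "inj_on (\<lambda>u. {v, u}) ({..<n} - {v})" by (auto simp: inj_on_def doubleton_eq_iff)
  ultimately show ?thesis using assms by (simp add: card_image)
qed

lemma card_two_stars:
  assumes "u < n" "v < n" "u \<noteq> v"
  shows "2 * n = card (star n u \<union> star n v) + 3"
proof -
  have "finite (star n w)" for w
    by (rule finite_subset[of _ "nsets {..<n} 2"]) (auto simp: star_def finite_imp_finite_nsets)
  hence "card (star n u) + card (star n v) = card (star n u \<union> star n v) + card (star n u \<inter> star n v)"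
    by (intro card_Un_Int)
  moreover have "star n u \<inter> star n v = {{u, v}}"
    using assms by (auto simp: star_def nsets_2_eq)
  ultimately show ?thesis using assms card_star by simp
qed

text \<open>
  The second moment method for the number \<open>X\<close> of isolated vertices. Two different vertices are
  isolated with probability \<open>a\<^sup>2 / (1 - q)\<close>, where \<open>a\<close> is the probability for one vertex, since
  their stars share one edge; hence the variance is at most \<open>m + m\<^sup>2 * q / (1 - q)\<close> for the mean
  \<open>m = n * a\<close>.
\<close>

lemma prob_no_isolated_vertex:
  assumes q: "0 \<le> q" "q < 1" and n: "n \<ge> 2"
  shows "measure_pmf.prob (random_graph n q) {E. \<forall>v<n. E \<inter> star n v \<noteq> {}}
    \<le> 1 / (real n * (1 - q) ^ (n - 1)) + q / (1 - q)"
proof -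
  let ?M = "measure_pmf.expectation (random_graph n q)"
  define a where "a = (1 - q) ^ (n - 1)"
  \<comment> \<open>The indicator of \<open>v\<close> being isolated, as \<open>0 ^ 0 = 1\<close>.\<close>
  define I :: "nat \<Rightarrow> nat set set \<Rightarrow> real" where "I v E = 0 ^ card (E \<inter> star n v)" for v E
  define X where "X E = (\<Sum>v<n. I v E)" for E
  define m where "m = real n * a"
  have "a > 0" "m > 0" using q n by (simp_all add: a_def m_def)
  have q': "q \<in> {0..1}" using q by simp
  note int = integrable_random_graph
  have fin: "finite (E \<inter> star n v)" for E v
    by (rule finite_subset[of _ "nsets {..<n} 2"]) (auto simp: star_def finite_imp_finite_nsets)
  have EI: "?M (I v) = a" if "v < n" for v
    unfolding I_def using that
    by (subst expectation_power_card[OF q']) (auto simp: a_def card_star, auto simp: star_def)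
  have EX: "?M X = m"
    unfolding X_def by (subst Bochner_Integration.integral_sum[OF int]) (simp add: EI m_def)
  have prodI: "I u E * I v E = 0 ^ card (E \<inter> (star n u \<union> star n v))" for u v E
    using fin[of E u] fin[of E v] by (auto simp: I_def power_0_left card_eq_0_iff Int_Un_distrib)
  have EII: "?M (\<lambda>E. I u E * I v E) \<le> (if u = v then a else 0) + a\<^sup>2 / (1 - q)" if "u < n" "v < n" for u v
  proof (cases "u = v")
    case True
    have "?M (\<lambda>E. I u E * I v E) = ?M (I v)"
      unfolding prodI using True by (simp add: I_def[abs_def])
    thus ?thesis using EI[OF that(2)] True q by simp
  next
    case False
    have "?M (\<lambda>E. I u E * I v E) = (1 - q) ^ card (star n u \<union> star n v)"
      unfolding prodI by (subst expectation_power_card[OF q']) (auto simp: star_def)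
    moreover have "(1 - q) * (1 - q) ^ card (star n u \<union> star n v) = a\<^sup>2"
    proof -
      have "Suc (card (star n u \<union> star n v)) = (n - 1) * 2"
        using card_two_stars[OF that False] n by linarith
      thus ?thesis unfolding a_def by (metis power_Suc power_mult)
    qed
    ultimately show ?thesis using False q by (simp add: field_simps)
  qed
  have "?M (\<lambda>E. X E * X E) = (\<Sum>u<n. \<Sum>v<n. ?M (\<lambda>E. I u E * I v E))"
    unfolding X_def sum_product
    by (subst Bochner_Integration.integral_sum[OF int], subst Bochner_Integration.integral_sum[OF int]) simp
  also have "\<dots> \<le> (\<Sum>u<n. \<Sum>v<n. (if u = v then a else 0) + a\<^sup>2 / (1 - q))"
    by (intro sum_mono EII) auto
  also have "\<dots> = m + m\<^sup>2 / (1 - q)"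
    by (simp add: sum.distrib m_def power2_eq_square algebra_simps)
  finally have EXX: "?M (\<lambda>E. X E * X E) \<le> m + m\<^sup>2 / (1 - q)" .
  have "measure_pmf.prob (random_graph n q) {E. \<forall>v<n. E \<inter> star n v \<noteq> {}}
      \<le> ?M (\<lambda>E. (X E - m)\<^sup>2 / m\<^sup>2)"
  proof (rule prob_random_graph_le)
    fix E assume "\<forall>v<n. E \<inter> star n v \<noteq> {}"
    hence "X E = 0"
      unfolding X_def I_def power_0_left card_eq_0_iff using fin by (intro sum.neutral) auto
    thus "1 \<le> (X E - m)\<^sup>2 / m\<^sup>2" using \<open>m > 0\<close> by simp
  qed auto
  also have "\<dots> = ?M (\<lambda>E. X E * X E - 2 * m * X E + m\<^sup>2) / m\<^sup>2"
    by (simp add: power2_diff power2_eq_square algebra_simps)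
  also have "?M (\<lambda>E. X E * X E - 2 * m * X E + m\<^sup>2) = ?M (\<lambda>E. X E * X E) - m\<^sup>2"
    by (simp add: int EX power2_eq_square)
  also have "\<dots> / m\<^sup>2 \<le> (m + m\<^sup>2 / (1 - q) - m\<^sup>2) / m\<^sup>2"
    using EXX \<open>m > 0\<close> by (intro divide_right_mono) auto
  also have "\<dots> = 1 / m + q / (1 - q)"
    using \<open>m > 0\<close> q by (simp add: field_simps power2_eq_square)
  finally show ?thesis by (simp add: m_def a_def)
qed

section \<open>Packings in dense random graphs\<close>

lemma sum_Pow_power_card:
  fixes x :: real
  assumes "finite V"
  shows "(\<Sum>S\<in>Pow V - {{}}. x ^ card S) = (1 + x) ^ card V - 1"
proof -
  have "(1 + x) ^ card V = (\<Prod>i\<in>V. x + 1)" by (simp add: add.commute)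
  also have "\<dots> = (\<Sum>S\<in>Pow V. x ^ card S)"
    using prod_add[OF assms, of "\<lambda>_. x" "\<lambda>_. 1"] by simp
  also have "\<dots> = (\<Sum>S\<in>Pow V - {{}}. x ^ card S) + 1"
    using assms by (subst sum.remove[of _ "{}"]) auto
  finally show ?thesis by simp
qed

text \<open>
  The union bound over all cuts. Bounding \<open>x ^ min a b\<close> by \<open>x ^ a + x ^ b\<close> reduces it to the
  binomial theorem.
\<close>

lemma sum_cuts:
  fixes x :: real
  assumes "finite V" "r \<in> V" "0 \<le> x"
  shows "(\<Sum>S\<in>Pow (V - {r}) - {{}}. x ^ min (card S) (card (V - S))) \<le> 2 * ((1 + x) ^ card V - 1)"
proof -
  let ?C = "Pow (V - {r}) - {{}}"
  have "(\<Sum>S\<in>?C. x ^ min (card S) (card (V - S))) \<le> (\<Sum>S\<in>?C. x ^ card S + x ^ card (V - S))"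
    using assms by (intro sum_mono) (auto simp: min_def)
  also have "\<dots> = (\<Sum>S\<in>?C. x ^ card S) + (\<Sum>S\<in>?C. x ^ card (V - S))" by (rule sum.distrib)
  also have "(\<Sum>S\<in>?C. x ^ card (V - S)) = (\<Sum>S\<in>(\<lambda>S. V - S) ` ?C. x ^ card S)"
    by (subst sum.reindex) (auto intro!: inj_onI)
  also have "(\<Sum>S\<in>?C. x ^ card S) + \<dots>
      \<le> (\<Sum>S\<in>Pow V - {{}}. x ^ card S) + (\<Sum>S\<in>Pow V - {{}}. x ^ card S)"
    using assms by (intro add_mono sum_mono2) auto
  also have "\<dots> = 2 * ((1 + x) ^ card V - 1)"
    by (simp add: sum_Pow_power_card[OF assms(1)])
  finally show ?thesis .
qed

text \<open>
  Choose \<open>K\<close> as the least number of trees with \<open>(K - k) * (n - 1) \<ge> f\<close>; it is at most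
  \<open>q * n / 32\<close>, because \<open>1\<close>, \<open>k\<close> and half of \<open>f / (n - 1)\<close> are at most \<open>q * n / 128\<close> each.
  On average at least \<open>q * m * n / 8\<close> oriented edges enter a set when \<open>m\<close> is the size of the smaller
  side of its cut, and there are at most \<open>K\<close> of them with probability at most
  \<open>exp (q * n / 32 - q * m * n / 16) \<le> exp (- (q * m * n / 32)) \<le> n powr (- 4 * m)\<close>,
  small enough for the union bound over the cuts.
\<close>

lemma prob_not_rmc_at_least:
  assumes q: "q \<in> {0..1}" and n: "n \<ge> 4" and k: "1 \<le> k" and f: "0 \<le> f"
    and qk: "128 * real k \<le> q * real n" and ql: "128 * ln (real n) \<le> q * real n"
    and qf: "128 * f \<le> q * (real n)\<^sup>2"
  shows "measure_pmf.prob (random_graph n q) {E. \<not> rmc_at_least k {..<n} f E}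
    \<le> 2 * ((1 + 1 / real n ^ 4) ^ n - 1)"
proof -
  let ?P = "measure_pmf.prob (random_graph n q)"
  define K where "K = k + nat \<lceil>f / (real n - 1)\<rceil>"
  define B where "B S = underlying (in_arcs (rotation n) S)" for S
  let ?C = "Pow ({..<n} - {0}) - {{}}"
  have "0 \<le> f / (real n - 1)" using f n by simp
  hence K1: "f / (real n - 1) \<le> real (K - k)" "real K \<le> real k + f / (real n - 1) + 1"
    unfolding K_def by linarith+
  have fK: "f \<le> real (K - k) * (real n - 1)"
    using K1(1) n by (simp add: field_simps)
  have "128 * (f / (real n - 1)) \<le> 128 * (f / (real n / 2))"
    using f n by (intro mult_left_mono divide_left_mono) auto
  also have "\<dots> \<le> 2 * (q * real n)"
    using qf n by (simp add: field_simps power2_eq_square)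
  finally have "128 * (f / (real n - 1)) \<le> 2 * (q * real n)" .
  moreover have "1 \<le> real k" using k by simp
  ultimately have Kq: "real K \<le> q * real n / 32"
    using K1(2) qk by linarith
  have sub: "B S \<subseteq> nsets {..<n} 2" for S
    using orientation_rotation[of n] by (auto simp: B_def in_arcs_def orientation_def)
  have "?P {E. \<not> rmc_at_least k {..<n} f E} \<le> ?P (\<Union>S\<in>?C. {E. real (card (E \<inter> B S)) \<le> real K})"
  proof (rule measure_pmf.finite_measure_mono_AE)
    have "\<exists>S\<in>?C. real (card (E \<inter> B S)) \<le> real K"
      if "E \<subseteq> nsets {..<n} 2" "\<not> rmc_at_least k {..<n} f E" for E
    proof (rule ccontr)
      assume large: "\<not> ?thesis"
      have "rmc_at_least k {..<n} f E"
      proof (rule rmc_at_least_of_in_cuts[OF _ _ that(1) orientation_rotation])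
        fix S assume "S \<subseteq> {..<n} - {0}" "S \<noteq> {}"
        hence "S \<in> ?C" by simp
        hence "real K < real (card (E \<inter> B S))" using large by (meson not_le)
        thus "K \<le> card (E \<inter> underlying (in_arcs (rotation n) S))" by (simp add: B_def)
      qed (use n fK in \<open>auto simp: K_def\<close>)
      thus False using that(2) by contradiction
    qed
    thus "AE E in random_graph n q. E \<in> {E. \<not> rmc_at_least k {..<n} f E} \<longrightarrow>
        E \<in> (\<Union>S\<in>?C. {E. real (card (E \<inter> B S)) \<le> real K})"
      using set_random_graph by (auto simp: AE_measure_pmf_iff)
  qed auto
  also have "\<dots> \<le> (\<Sum>S\<in>?C. ?P {E. real (card (E \<inter> B S)) \<le> real K})"
    by (intro measure_pmf.finite_measure_subadditive_finite) auto
  also have "\<dots> \<le> (\<Sum>S\<in>?C. (1 / real n ^ 4) ^ min (card S) (card ({..<n} - S)))"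
  proof (rule sum_mono)
    fix S assume S: "S \<in> ?C"
    define m where "m = min (card S) (card ({..<n} - S))"
    have "finite S" "S \<noteq> {}" "0 \<in> {..<n} - S" using S n by (auto intro: finite_subset)
    hence m: "1 \<le> m" unfolding m_def
      by (metis One_nat_def Suc_leI card_gt_0_iff empty_iff finite_Diff finite_lessThan min_less_iff_conj)
    have cut: "real m * real n / 8 \<le> real (card (B S))"
      unfolding m_def B_def using S by (intro rotation_cut[OF n]) auto
    have "?P {E. real (card (E \<inter> B S)) \<le> real K} \<le> exp (real K - q * real (card (B S)) / 2)"
      by (rule prob_few_edges[OF q sub])
    also have "\<dots> \<le> exp (- (real m * (4 * ln (real n))))"
    proof (subst exp_le_cancel_iff)
      have "real K \<le> q * real n / 32 * real m"
        using Kq m q mult_left_mono[of 1 "real m" "q * real n / 32"] by auto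
      moreover have "q * (real m * real n / 8) \<le> q * real (card (B S))"
        using cut q by (intro mult_left_mono) auto
      moreover have "real m * (128 * ln (real n)) \<le> real m * (q * real n)"
        using ql by (intro mult_left_mono) auto
      ultimately show "real K - q * real (card (B S)) / 2 \<le> - (real m * (4 * ln (real n)))"
        by (simp add: algebra_simps)
    qed
    also have "\<dots> = (1 / real n ^ 4) ^ m"
    proof -
      have "exp (4 * ln (real n)) = real n ^ 4"
        using n exp_of_nat_mult[of 4 "ln (real n)"] by simp
      hence "exp (real m * (4 * ln (real n))) = (real n ^ 4) ^ m" by (simp add: exp_of_nat_mult)
      thus ?thesis by (simp add: exp_minus power_one_over inverse_eq_divide)
    qed
    finally show "?P {E. real (card (E \<inter> B S)) \<le> real K} \<le> (1 / real n ^ 4) ^ min (card S) (card ({..<n} - S))"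
      by (simp add: m_def)
  qed
  also have "\<dots> \<le> 2 * ((1 + 1 / real n ^ 4) ^ card {..<n} - 1)"
    using n by (intro sum_cuts) auto
  finally show ?thesis by simp
qed

lemma almost_surelyI:
  assumes "\<forall>\<^sub>F n in sequentially. measure_pmf.prob (random_graph n (q n)) {E. \<not> Q n E} \<le> b n"
    and "b \<longlonglongrightarrow> 0"
  shows "almost_surely q Q"
  unfolding almost_surely_def
proof (rule tendsto_sandwich)
  have "measure_pmf.prob (random_graph n (q n)) {E. Q n E}
      = 1 - measure_pmf.prob (random_graph n (q n)) {E. \<not> Q n E}" for n
    by (subst measure_pmf.prob_compl[symmetric]) (auto intro!: arg_cong[where f = "measure_pmf.prob _"])
  thus "\<forall>\<^sub>F n in sequentially. 1 - b n \<le> measure_pmf.prob (random_graph n (q n)) {E. Q n E}"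
    using assms(1) by (auto elim: eventually_mono)
  show "(\<lambda>n. 1 - b n) \<longlonglongrightarrow> 1" using tendsto_diff[OF tendsto_const assms(2), of 1] by simp
qed auto

section \<open>The threshold\<close>

text \<open>
  Here even the number of edges stays below \<open>f\<close>: its mean is at most \<open>f / 4\<close>.
\<close>

lemma almost_surely_not_rmc_of_sparse:
  assumes q: "\<And>n. q n \<in> {0..1}" and lim: "filterlim f at_top sequentially"
    and sparse: "\<forall>\<^sub>F n in sequentially. q n * (real n)\<^sup>2 \<le> f n / 2"
  shows "almost_surely q (\<lambda>n E. \<not> rmc_at_least (k n) {..<n} (f n) E)"
proof (rule almost_surelyI)
  show "\<forall>\<^sub>F n in sequentially.
      measure_pmf.prob (random_graph n (q n)) {E. \<not> \<not> rmc_at_least (k n) {..<n} (f n) E}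
      \<le> exp (- (f n / 4))"
    using sparse
  proof eventually_elim
    case (elim n)
    let ?N = "nsets {..<n} 2"
    have "measure_pmf.prob (random_graph n (q n)) {E. \<not> \<not> rmc_at_least (k n) {..<n} (f n) E}
        \<le> measure_pmf.prob (random_graph n (q n)) {E. f n \<le> real (card (E \<inter> ?N))}"
    proof (rule measure_pmf.finite_measure_mono_AE)
      have "f n \<le> real (card (E \<inter> ?N))" if "E \<subseteq> ?N" "rmc_at_least (k n) {..<n} (f n) E" for E
        using that rmc_at_least_card[OF finite_subset[OF that(1)] that(2)]
        by (simp add: finite_imp_finite_nsets Int_absorb2)
      thus "AE E in random_graph n (q n). E \<in> {E. \<not> \<not> rmc_at_least (k n) {..<n} (f n) E} \<longrightarrow>
          E \<in> {E. f n \<le> real (card (E \<inter> ?N))}"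
        using set_random_graph by (auto simp: AE_measure_pmf_iff)
    qed auto
    also have "\<dots> \<le> exp (q n * real (card ?N) - f n / 2)"
      using q by (intro prob_many_edges) auto
    also have "\<dots> \<le> exp (- (f n / 4))"
    proof (subst exp_le_cancel_iff)
      have "?N = {B. B \<subseteq> {..<n} \<and> card B = 2}"
        by (auto simp: nsets_def intro: finite_subset)
      hence "card ?N = n choose 2" by (simp add: n_subsets)
      hence "2 * card ?N \<le> n * (n - 1)" by (simp add: choose_two)
      also have "\<dots> \<le> n\<^sup>2" by (simp add: power2_eq_square)
      finally have "2 * card ?N \<le> n\<^sup>2" .
      hence "real (2 * card ?N) \<le> real (n\<^sup>2)" by (rule of_nat_mono)
      hence "q n * real (card ?N) \<le> q n * ((real n)\<^sup>2 / 2)"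
        using q[of n] by (intro mult_left_mono) auto
      thus "q n * real (card ?N) - f n / 2 \<le> - (f n / 4)" using elim by simp
    qed
    finally show ?case .
  qed
  have "filterlim (\<lambda>n. f n * (1 / 4)) at_top sequentially"
    by (rule filterlim_at_top_mult_tendsto_pos[OF tendsto_const _ lim]) simp
  hence "filterlim (\<lambda>n. - (f n / 4)) at_bot sequentially" by (simp add: filterlim_uminus_at_top)
  thus "(\<lambda>n. exp (- (f n / 4))) \<longlonglongrightarrow> 0" by (rule filterlim_compose[OF exp_at_bot])
qed

text \<open>
  Here some vertex is isolated: the expected number of isolated vertices is at least \<open>sqrt n\<close>.
\<close>

lemma almost_surely_not_rmc_below_log:
  assumes q: "\<And>n. q n \<in> {0..1}" and k: "\<forall>\<^sub>F n in sequentially. 1 \<le> k n"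
    and small: "\<forall>\<^sub>F n in sequentially. q n \<le> ln (real n) / (4 * real n)"
  shows "almost_surely q (\<lambda>n E. \<not> rmc_at_least (k n) {..<n} (f n) E)"
proof (rule almost_surelyI)
  have "\<forall>\<^sub>F n in sequentially. ln (real n) / (4 * real n) \<le> 1 / 2" by real_asymp
  with k small eventually_ge_at_top[of 2]
  show "\<forall>\<^sub>F n in sequentially.
      measure_pmf.prob (random_graph n (q n)) {E. \<not> \<not> rmc_at_least (k n) {..<n} (f n) E}
      \<le> 1 / sqrt (real n) + ln (real n) / (2 * real n)"
  proof eventually_elim
    case (elim n)
    define p where "p = q n"
    have p: "0 \<le> p" "p \<le> 1 / 2" using q[of n] elim(2,4) unfolding p_def by auto
    have p4: "4 * (real n * p) \<le> ln (real n)" using elim by (simp add: p_def field_simps)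
    have "measure_pmf.prob (random_graph n p) {E. \<not> \<not> rmc_at_least (k n) {..<n} (f n) E}
        \<le> measure_pmf.prob (random_graph n p) {E. \<forall>v<n. E \<inter> star n v \<noteq> {}}"
    proof (rule measure_pmf.finite_measure_mono_AE)
      have "E \<inter> star n v \<noteq> {}"
        if "E \<subseteq> nsets {..<n} 2" "rmc_at_least (k n) {..<n} (f n) E" "v < n" for E v
      proof -
        obtain u where "u < n" "u \<noteq> v" using elim(3) by (cases "v = 0") (force intro: that[of 1], force intro: that[of 0])
        thus ?thesis
          using rmc_at_least_no_isolated[OF that(2) elim(1), of v u] that by (auto simp: star_def)
      qed
      thus "AE E in random_graph n p. E \<in> {E. \<not> \<not> rmc_at_least (k n) {..<n} (f n) E} \<longrightarrow>
          E \<in> {E. \<forall>v<n. E \<inter> star n v \<noteq> {}}"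
        using set_random_graph by (auto simp: AE_measure_pmf_iff)
    qed auto
    also have "\<dots> \<le> 1 / (real n * (1 - p) ^ (n - 1)) + p / (1 - p)"
      using p elim by (intro prob_no_isolated_vertex) auto
    also have "\<dots> \<le> 1 / sqrt (real n) + ln (real n) / (2 * real n)"
    proof (rule add_mono)
      have n: "real n > 0" using elim by simp
      have "- (2 * p) \<le> ln (1 - p)"
      proof -
        have "p * p \<le> p * (1 / 2)" using p by (intro mult_left_mono) auto
        thus ?thesis using ln_one_minus_pos_lower_bound[OF p(1,2)] by (simp add: power2_eq_square)
      qed
      hence "exp (- (2 * p)) \<le> exp (ln (1 - p))" by simp
      hence p1: "exp (- (2 * p)) \<le> 1 - p" using p by simp
      \<comment> \<open>By the choice of the constant \<open>4\<close>, \<open>(1 - p) ^ n \<ge> exp (- 2 * p * n) \<ge> 1 / sqrt n\<close>.\<close>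
      have "1 / sqrt (real n) = exp (- (ln (real n) / 2))"
        using n by (simp add: exp_minus inverse_eq_divide flip: ln_sqrt)
      also have "\<dots> \<le> exp (real n * (- (2 * p)))" using p4 by simp
      also have "\<dots> = exp (- (2 * p)) ^ n" by (rule exp_of_nat_mult)
      also have "\<dots> \<le> exp (- (2 * p)) ^ (n - 1)" using p by (intro power_decreasing) auto
      also have "\<dots> \<le> (1 - p) ^ (n - 1)" using p1 by (intro power_mono) auto
      finally have "real n * (1 / sqrt (real n)) \<le> real n * (1 - p) ^ (n - 1)"
        using n by (intro mult_left_mono) auto
      hence "sqrt (real n) \<le> real n * (1 - p) ^ (n - 1)" using n by (simp add: real_div_sqrt)
      thus "1 / (real n * (1 - p) ^ (n - 1)) \<le> 1 / sqrt (real n)"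
        using n p by (intro divide_left_mono) auto
      have "p / (1 - p) \<le> p / (1 / 2)" using p by (intro divide_left_mono) auto
      also have "\<dots> \<le> ln (real n) / (2 * real n)" using p4 n by (simp add: field_simps)
      finally show "p / (1 - p) \<le> ln (real n) / (2 * real n)" .
    qed
    finally show ?case by (simp add: p_def)
  qed
  show "(\<lambda>n. 1 / sqrt (real n) + ln (real n) / (2 * real n)) \<longlonglongrightarrow> 0" by real_asymp
qed

lemma almost_surely_rmc_of_dense:
  assumes q: "\<And>n. q n \<in> {0..1}"
    and k: "\<forall>\<^sub>F n in sequentially. 1 \<le> k n" and f: "\<forall>\<^sub>F n in sequentially. 0 \<le> f n"
    and qk: "\<forall>\<^sub>F n in sequentially. 128 * real (k n) \<le> q n * real n"
    and ql: "\<forall>\<^sub>F n in sequentially. 128 * ln (real n) \<le> q n * real n"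
    and qf: "\<forall>\<^sub>F n in sequentially. 128 * f n \<le> q n * (real n)\<^sup>2"
  shows "almost_surely q (\<lambda>n. rmc_at_least (k n) {..<n} (f n))"
proof (rule almost_surelyI)
  show "\<forall>\<^sub>F n in sequentially.
      measure_pmf.prob (random_graph n (q n)) {E. \<not> rmc_at_least (k n) {..<n} (f n) E}
      \<le> 2 * ((1 + 1 / real n ^ 4) ^ n - 1)"
    using eventually_ge_at_top[of 4] k f qk ql qf
    by eventually_elim (rule prob_not_rmc_at_least[OF q])
  show "(\<lambda>n. 2 * ((1 + 1 / real n ^ 4) ^ n - 1)) \<longlonglongrightarrow> 0" by real_asymp
qed

lemma random_graph_1: "random_graph n 1 = return_pmf (nsets {..<n} 2)"
proof -
  have "bernoulli_pmf 1 = return_pmf True"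
  proof (rule pmf_eqI)
    show "pmf (bernoulli_pmf 1) i = pmf (return_pmf True) i" for i by (cases i) auto
  qed
  thus ?thesis
    by (simp add: random_graph_def Pi_pmf_return_pmf finite_imp_finite_nsets)
qed

lemma almost_surely_rmc_of_complete:
  assumes "\<forall>\<^sub>F n in sequentially. q n = 1"
    and "\<forall>\<^sub>F n in sequentially. k n < n div 2"
    and "\<forall>\<^sub>F n in sequentially. f n < real (rmc (k n) {..<n} (nsets {..<n} 2))"
  shows "almost_surely q (\<lambda>n. rmc_at_least (k n) {..<n} (f n))"
proof (rule almost_surelyI)
  show "\<forall>\<^sub>F n in sequentially.
      measure_pmf.prob (random_graph n (q n)) {E. \<not> rmc_at_least (k n) {..<n} (f n) E} \<le> 0"
    using assms
    by eventually_elim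
      (simp add: random_graph_1 rmc_at_least_def rmc_coloring_complete_graph)
qed simp

theorem theorem5p5:
  fixes k :: "nat \<Rightarrow> nat" and f :: "nat \<Rightarrow> real"
  assumes "\<forall>\<^sub>F n in sequentially. 1 \<le> k n \<and> k n < n div 2"
    and "\<forall>\<^sub>F n in sequentially. real (k n) * (real n - 1) \<le> f n
           \<and> f n < real (rmc (k n) {..<n} (nsets {..<n} 2))"
  shows
    "((\<exists>s>0. \<forall>\<^sub>F n in sequentially. f n \<ge> s * real n * ln (real n)) \<and>
        (\<lambda>n. real (k n)) \<in> o(\<lambda>n. real n) \<longrightarrow>
      sharp_threshold (\<lambda>n. (f n + real (k n) * real n) / (real n)\<^sup>2)
        (\<lambda>n. rmc_at_least (k n) {..<n} (f n))) \<and>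
     (f \<in> o(\<lambda>n. real n * ln (real n)) \<and> (\<lambda>n. real (k n)) \<in> o(\<lambda>n. real n) \<longrightarrow>
      sharp_threshold (\<lambda>n. max (real (k n) / real n) (ln (real n) / real n))
        (\<lambda>n. rmc_at_least (k n) {..<n} (f n))) \<and>
     ((\<exists>l>0. \<forall>\<^sub>F n in sequentially. real (k n) \<ge> l * real n) \<longrightarrow>
      sharp_threshold (\<lambda>n. 1)
        (\<lambda>n. rmc_at_least (k n) {..<n} (f n)))"
proof (intro conjI impI; (elim conjE exE)?)
  have k1: "\<forall>\<^sub>F n in sequentially. 1 \<le> k n"
    using assms(1) by (auto elim: eventually_mono)
  have fk: "\<forall>\<^sub>F n in sequentially. real (k n) * real n \<le> 2 * f n"
    using assms(2) eventually_ge_at_top[of 2]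
  proof eventually_elim
    case (elim n)
    have "real (k n) * real n \<le> real (k n) * (2 * (real n - 1))"
      using elim by (intro mult_left_mono) auto
    also have "\<dots> = 2 * (real (k n) * (real n - 1))" by simp
    finally show ?case using elim(1) by linarith
  qed
  have fn: "\<forall>\<^sub>F n in sequentially. real n \<le> 2 * f n"
    using k1 fk
  proof eventually_elim
    case (elim n)
    have "1 * real n \<le> real (k n) * real n" using elim(1) by (intro mult_right_mono) auto
    thus ?case using elim by simp
  qed
  have f0: "\<forall>\<^sub>F n in sequentially. 0 \<le> f n"
    using fn
  proof eventually_elim
    case (elim n)
    have "0 \<le> real n" by simp
    with elim show ?case by linarith
  qed
  have flim: "filterlim f at_top sequentially"
  proof (rule filterlim_at_top_mono)
    show "filterlim (\<lambda>n. real n / 2) at_top sequentially" by real_asymp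
    show "\<forall>\<^sub>F n in sequentially. real n / 2 \<le> f n" using fn by eventually_elim simp
  qed
  note n1 = eventually_gt_at_top[of "1::nat"]

  {
    fix s :: real assume s: "0 < s" "\<forall>\<^sub>F n in sequentially. s * real n * ln (real n) \<le> f n"
    show "sharp_threshold (\<lambda>n. (f n + real (k n) * real n) / (real n)\<^sup>2)
        (\<lambda>n. rmc_at_least (k n) {..<n} (f n))"
      unfolding sharp_threshold_def
    \<comment> \<open>As \<open>k n \<le> 2 f\<close>, the constant \<open>1 / 6\<close> turns the first bound into \<open>q n\<^sup>2 \<le> f / 2\<close>; the summand \<open>128 / s\<close> turns \<open>f \<ge> s n ln n\<close> into \<open>q n \<ge> 128 ln n\<close>.\<close>
    proof (rule exI[of _ "1 / 6"], intro conjI, simp, rule exI[of _ "128 + 128 / s"], intro conjI allI impI)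
      show "128 + 128 / s > 0" using s(1) by (intro add_pos_pos divide_pos_pos) auto
    next
      fix q :: "nat \<Rightarrow> real" assume q: "\<forall>n. q n \<in> {0..1}"
        and qh: "\<forall>\<^sub>F n in sequentially. q n \<le> 1 / 6 * ((f n + real (k n) * real n) / (real n)\<^sup>2)"
      have "\<forall>\<^sub>F n in sequentially. q n * (real n)\<^sup>2 \<le> f n / 2"
        using qh fk n1 by eventually_elim (simp add: field_simps)
      thus "almost_surely q (\<lambda>n E. \<not> rmc_at_least (k n) {..<n} (f n) E)"
        using q flim by (intro almost_surely_not_rmc_of_sparse) auto
    next
      fix q :: "nat \<Rightarrow> real" assume q: "\<forall>n. q n \<in> {0..1}"
        and qh: "\<forall>\<^sub>F n in sequentially. (128 + 128 / s) * ((f n + real (k n) * real n) / (real n)\<^sup>2) \<le> q n"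
      have "\<forall>\<^sub>F n in sequentially. 128 * real (k n) \<le> q n * real n \<and>
          128 * ln (real n) \<le> q n * real n \<and> 128 * f n \<le> q n * (real n)\<^sup>2"
        using qh s(2) f0 n1
      proof eventually_elim
        case (elim n)
        have n: "real n > 0" using elim by simp
        define t where "t = 128 / s"
        have t: "0 < t" using s(1) by (simp add: t_def)
        have qn: "(128 + t) * (f n + real (k n) * real n) \<le> q n * (real n)\<^sup>2"
          using elim(1) n by (simp add: t_def field_simps)
        have nonneg: "0 \<le> f n" "0 \<le> real (k n) * real n" "0 \<le> t * f n" "0 \<le> t * (real (k n) * real n)"
          using elim(3) n t by auto
        have "128 * f n + 128 * (real (k n) * real n) + t * f n + t * (real (k n) * real n)
            \<le> q n * (real n)\<^sup>2"
          using qn by (simp add: algebra_simps)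
        moreover have "128 * (real n * ln (real n)) \<le> t * f n"
          using elim(2) s(1) by (simp add: t_def field_simps)
        ultimately have "128 * (real (k n) * real n) \<le> q n * (real n)\<^sup>2"
          "128 * (real n * ln (real n)) \<le> q n * (real n)\<^sup>2" "128 * f n \<le> q n * (real n)\<^sup>2"
          using nonneg by linarith+
        thus ?case using n by (simp add: power2_eq_square)
      qed
      thus "almost_surely q (\<lambda>n. rmc_at_least (k n) {..<n} (f n))"
        using q k1 f0 by (intro almost_surely_rmc_of_dense) (auto elim: eventually_mono)
    qed
  }

  {
    assume fo: "f \<in> o(\<lambda>n. real n * ln (real n))"
    have fln: "\<forall>\<^sub>F n in sequentially. 2 * f n \<le> real n * ln (real n)"
    proof -
      have "\<forall>\<^sub>F n in sequentially. norm (f n) \<le> 1 / 2 * norm (real n * ln (real n))"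
        using fo by (rule landau_o.smallD) simp
      thus ?thesis using f0 n1 by eventually_elim auto
    qed
    \<comment> \<open>As \<open>k n \<le> 2 f\<close> and \<open>f = o(n ln n)\<close>, the maximum in the threshold is in fact eventually \<open>ln n / n\<close>.\<close>
    have kln: "\<forall>\<^sub>F n in sequentially. real (k n) \<le> ln (real n)"
      using fln fk n1
    proof eventually_elim
      case (elim n)
      hence "real n * real (k n) \<le> real n * ln (real n)" by (metis mult.commute order_trans)
      thus ?case using elim(3) by simp
    qed
    show "sharp_threshold (\<lambda>n. max (real (k n) / real n) (ln (real n) / real n))
        (\<lambda>n. rmc_at_least (k n) {..<n} (f n))"
      unfolding sharp_threshold_def
    proof (rule exI[of _ "1 / 4"], intro conjI, simp, rule exI[of _ "128"], intro conjI allI impI)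
      fix q :: "nat \<Rightarrow> real" assume q: "\<forall>n. q n \<in> {0..1}"
        and qh: "\<forall>\<^sub>F n in sequentially. q n \<le> 1 / 4 * max (real (k n) / real n) (ln (real n) / real n)"
      have "\<forall>\<^sub>F n in sequentially. q n \<le> ln (real n) / (4 * real n)"
        using qh kln n1
      proof eventually_elim
        case (elim n)
        have "real (k n) / real n \<le> ln (real n) / real n" using elim by (intro divide_right_mono) auto
        thus ?case using elim(1) by simp
      qed
      thus "almost_surely q (\<lambda>n E. \<not> rmc_at_least (k n) {..<n} (f n) E)"
        using q k1 by (intro almost_surely_not_rmc_below_log) auto
    next
      fix q :: "nat \<Rightarrow> real" assume q: "\<forall>n. q n \<in> {0..1}"
        and qh: "\<forall>\<^sub>F n in sequentially. 128 * max (real (k n) / real n) (ln (real n) / real n) \<le> q n"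
      have "\<forall>\<^sub>F n in sequentially. 128 * real (k n) \<le> q n * real n \<and>
          128 * ln (real n) \<le> q n * real n \<and> 128 * f n \<le> q n * (real n)\<^sup>2"
        using qh fln f0 n1
      proof eventually_elim
        case (elim n)
        have n: "real n > 0" using elim by simp
        have "128 * (real (k n) / real n) \<le> q n" "128 * (ln (real n) / real n) \<le> q n"
          using elim(1) by auto
        hence *: "128 * real (k n) \<le> q n * real n" "128 * ln (real n) \<le> q n * real n"
          using n by (simp_all add: field_simps)
        have "128 * f n \<le> real n * (128 * ln (real n))" using elim(2,3) by simp
        also have "\<dots> \<le> real n * (q n * real n)" using * n by (intro mult_left_mono) auto
        finally show ?case using * by (simp add: power2_eq_square mult_ac)
      qed
      thus "almost_surely q (\<lambda>n. rmc_at_least (k n) {..<n} (f n))"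
        using q k1 f0 by (intro almost_surely_rmc_of_dense) (auto elim: eventually_mono)
    qed simp
  }

  {
    fix l :: real assume l: "0 < l" "\<forall>\<^sub>F n in sequentially. l * real n \<le> real (k n)"
    show "sharp_threshold (\<lambda>n. 1) (\<lambda>n. rmc_at_least (k n) {..<n} (f n))"
      unfolding sharp_threshold_def
    \<comment> \<open>For \<open>c2 = 1\<close> the graph is eventually complete, and the bound \<open>f < rmc\<close> applies to it.\<close>
    proof (rule exI[of _ "l / 4"], intro conjI, use l in simp, rule exI[of _ "1"], intro conjI allI impI)
      fix q :: "nat \<Rightarrow> real" assume q: "\<forall>n. q n \<in> {0..1}"
        and qh: "\<forall>\<^sub>F n in sequentially. q n \<le> l / 4 * 1"
      have "\<forall>\<^sub>F n in sequentially. q n * (real n)\<^sup>2 \<le> f n / 2"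
        using qh fk l(2)
      proof eventually_elim
        case (elim n)
        have "q n * (real n)\<^sup>2 \<le> l / 4 * (real n)\<^sup>2" using elim(1) by (intro mult_right_mono) auto
        moreover have "l * real n * real n \<le> real (k n) * real n"
          using elim(3) by (intro mult_right_mono) auto
        ultimately show ?case using elim(2) by (simp add: power2_eq_square)
      qed
      thus "almost_surely q (\<lambda>n E. \<not> rmc_at_least (k n) {..<n} (f n) E)"
        using q flim by (intro almost_surely_not_rmc_of_sparse) auto
    next
      fix q :: "nat \<Rightarrow> real" assume q: "\<forall>n. q n \<in> {0..1}"
        and qh: "\<forall>\<^sub>F n in sequentially. 1 * 1 \<le> q n"
      have "\<forall>\<^sub>F n in sequentially. q n = 1"
        using qh by eventually_elim (use q in \<open>simp add: order_antisym\<close>)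
      thus "almost_surely q (\<lambda>n. rmc_at_least (k n) {..<n} (f n))"
        using assms by (intro almost_surely_rmc_of_complete) (auto elim: eventually_mono)
    qed simp
  }
qed

end
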